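(* For every Korselt number ($KN$) $n$, $$q\le Q_2\left(N_2^{-1}(n)\right)=q_2\left(n_2^{-1}(n)\right),$$ with equality if and only if $q=Q_2(P)=(P-1)\left(2P+\frac12-\sqrt{P-\frac34}\right)+1$. Explicitly, $$q\le\left\lfloor \sqrt[5]{2n^2}-\sqrt[10]{\frac{n^3}{64}}-\frac1{10}\sqrt[5]{\frac n4}+\frac{17}{20}\sqrt[10]{\frac n4}\right\rfloor .$$
   Context: A Korselt number ($KN$) is an integer $n$ together with a factorisation $n=\prod_{i=1}^d p_i$, where $d\ge 3$ and $1<p_1<p_2<\dots<p_d$ are odd integers (not necessarily prime), such that $p_i-1$ divides $n-1$ for every $i$, and such that $E:=\dfrac{n/p_d-1}{p_d-1}$ (which is an integer by the divisibility condition) satisfies $E\ge 2$. Notation: $P:=\prod_{i=1}^{d-2}p_i$, $q:=p_{d-1}$, $r:=p_d$, so that $n=Pqr$. The functions of a real variable used are: $Q_2(x):=(x-1)\left(2x+\frac12-\sqrt{x-\frac34}\right)+1$ and $N_2(x):=4x^5-7x^4+7x^3-4x^2+x$ for $x\ge 1$; and, for $s\ge 0$, $p_2(s):=s^2+s+1$, $q_2(s):=2s^4+3s^3+3s^2+2s+1$, $r_2(s):=2s^4+5s^3+6s^2+3s+1$, $n_2(s):=p_2(s)\,q_2(s)\,r_2(s)$. Both $N_2$ on $[1,\infty)$ and $n_2$ on $[0,\infty)$ are strictly increasing bijections onto $[1,\infty)$, and $N_2^{-1}$, $n_2^{-1}$ denote their inverses. *)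

theory Defs
  imports Complex_Main
begin

(* The factors are p 1, ..., p d; values of p outside {1..d} are irrelevant.
   Both divisions in the last condition are exact: p d divides n, and
   n div p d - 1 = (n - 1) - (p d - 1) * (n div p d) is a multiple of p d - 1.
   So the quotient is the integer E = (n / p_d - 1) / (p_d - 1). *)
definition korselt_number :: "int \<Rightarrow> nat \<Rightarrow> (nat \<Rightarrow> int) \<Rightarrow> bool" where
  "korselt_number n d p \<longleftrightarrow>
     d \<ge> 3 \<and>
     n = (\<Prod>i=1..d. p i) \<and>
     (\<forall>i\<in>{1..d}. 1 < p i \<and> odd (p i)) \<and>
     strict_mono_on {1..d} p \<and>
     (\<forall>i\<in>{1..d}. (p i - 1) dvd (n - 1)) \<and>
     (n div p d - 1) div (p d - 1) \<ge> 2"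

definition Q2 :: "real \<Rightarrow> real" where
  "Q2 x = (x - 1) * (2 * x + 1/2 - sqrt (x - 3/4)) + 1"

definition N2 :: "real \<Rightarrow> real" where
  "N2 x = 4 * x^5 - 7 * x^4 + 7 * x^3 - 4 * x^2 + x"

definition p2 :: "real \<Rightarrow> real" where
  "p2 s = s^2 + s + 1"

definition q2 :: "real \<Rightarrow> real" where
  "q2 s = 2 * s^4 + 3 * s^3 + 3 * s^2 + 2 * s + 1"

definition r2 :: "real \<Rightarrow> real" where
  "r2 s = 2 * s^4 + 5 * s^3 + 6 * s^2 + 3 * s + 1"

definition n2 :: "real \<Rightarrow> real" where
  "n2 s = p2 s * q2 s * r2 s"

(* N2_bij and n2_bij below show that these inverses are well defined on {1..}. *)
definition N2_inv :: "real \<Rightarrow> real" where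
  "N2_inv = the_inv_into {1..} N2"

definition n2_inv :: "real \<Rightarrow> real" where
  "n2_inv = the_inv_into {0..} n2"

lemma bij_betw_of_strict_mono_ge_id:
  fixes f :: "real \<Rightarrow> real"
  assumes mono: "strict_mono_on {a..} f" and cont: "continuous_on {a..} f"
    and fa: "f a = 1" and ge: "\<And>x. x \<ge> a \<Longrightarrow> f x \<ge> x"
  shows "bij_betw f {a..} {1..}"
proof (rule bij_betw_imageI)
  show "inj_on f {a..}"
    using mono by (rule strict_mono_on_imp_inj_on)
  show "f ` {a..} = {1..}"
  proof (intro equalityI subsetI)
    fix y assume "y \<in> f ` {a..}"
    then obtain x where x: "x \<ge> a" "y = f x" by auto
    have "f a \<le> f x"
      using strict_mono_onD[OF mono, of a x] x by (cases "x = a") auto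
    then show "y \<in> {1..}" using x fa by simp
  next
    fix y :: real assume y: "y \<in> {1..}"
    let ?b = "max a y"
    have "y \<le> f ?b" using ge[of ?b] by linarith
    moreover have "continuous_on {a..?b} f"
      using cont by (rule continuous_on_subset) auto
    ultimately obtain x where "a \<le> x" "f x = y"
      using IVT'[of f a y ?b] y fa by auto
    then show "y \<in> f ` {a..}" by auto
  qed
qed

lemma N2_factor: "N2 x = x * ((x - 1) * (4 * x^3 - 3 * x^2 + 4 * x) + 1)"
  by (simp add: N2_def algebra_simps power_numeral_reduce)

lemma N2_strict_mono: "strict_mono_on {1..} N2"
proof (rule strict_mono_onI)
  fix x y :: real assume "x \<in> {1..}" "y \<in> {1..}" "x < y"
  then have x: "1 \<le> x" and xy: "x < y" by auto
  show "N2 x < N2 y"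
  proof (rule DERIV_pos_imp_increasing[OF xy])
    fix t assume "x \<le> t" "t \<le> y"
    then have t: "1 \<le> t" using x by simp
    have "(N2 has_real_derivative (20 * t^4 - 28 * t^3 + 21 * t^2 - 8 * t + 1)) (at t)"
      unfolding N2_def by (auto intro!: derivative_eq_intros)
    moreover have "20 * t^4 - 28 * t^3 + 21 * t^2 - 8 * t + 1
        = t^2 * (20 * (t - 7/10)^2 + 16/5) + 8 * t * (t - 1) + 1"
      by (simp add: field_simps power_numeral_reduce)
    moreover have "t^2 * (20 * (t - 7/10)^2 + 16/5) \<ge> 0" "8 * t * (t - 1) \<ge> 0"
      using t by auto
    ultimately show "\<exists>D. (N2 has_real_derivative D) (at t) \<and> D > 0"
      by (intro exI[of _ "20 * t^4 - 28 * t^3 + 21 * t^2 - 8 * t + 1"]) linarith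
  qed
qed

lemma N2_bij: "bij_betw N2 {1..} {1..}"
proof (rule bij_betw_of_strict_mono_ge_id[OF N2_strict_mono])
  show "continuous_on {1..} N2"
    unfolding N2_def by (intro continuous_intros)
  show "N2 1 = 1" by (simp add: N2_def)
  fix x :: real assume x: "1 \<le> x"
  have "4 * x^3 - 3 * x^2 + 4 * x = x * (x^2 + 3 * (x - 1/2)^2 + 13/4)"
    by (simp add: field_simps power_numeral_reduce)
  then have "4 * x^3 - 3 * x^2 + 4 * x \<ge> 0" using x by simp
  then have "(x - 1) * (4 * x^3 - 3 * x^2 + 4 * x) + 1 \<ge> 1" using x by simp
  then show "x \<le> N2 x"
    unfolding N2_factor using x mult_left_mono[of 1 _ x] by simp
qed

lemma n2_strict_mono: "strict_mono_on {0..} n2"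
proof (rule strict_mono_onI)
  fix x y :: real assume "x \<in> {0..}" "y \<in> {0..}" "x < y"
  then have xy: "0 \<le> x" "x < y" by auto
  have pow: "x^k \<le> y^k" for k using xy by (intro power_mono) auto
  have "p2 x < p2 y" "q2 x < q2 y" "r2 x < r2 y"
    unfolding p2_def q2_def r2_def using pow[of 2] pow[of 3] pow[of 4] xy by linarith+
  moreover have "0 \<le> p2 x" "0 \<le> q2 x" "0 \<le> r2 x"
    using xy by (auto simp: p2_def q2_def r2_def)
  ultimately show "n2 x < n2 y"
    unfolding n2_def by (intro mult_strict_mono) auto
qed

lemma n2_bij: "bij_betw n2 {0..} {1..}"
proof (rule bij_betw_of_strict_mono_ge_id[OF n2_strict_mono])
  show "continuous_on {0..} n2"
    unfolding n2_def p2_def q2_def r2_def by (intro continuous_intros)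
  show "n2 0 = 1" by (simp add: n2_def p2_def q2_def r2_def)
  fix x :: real assume x: "0 \<le> x"
  have 1: "p2 x \<ge> 1" "q2 x \<ge> 1" "r2 x \<ge> 1" "p2 x \<ge> x"
    using x by (auto simp: p2_def q2_def r2_def)
  have "x \<le> p2 x * 1 * 1" using 1 by simp
  also have "\<dots> \<le> p2 x * q2 x * r2 x"
    using 1 by (intro mult_mono) auto
  finally show "x \<le> n2 x" by (simp add: n2_def)
qed

end

theory Submission
  imports Defs
begin

text \<open>
  Put D = (P r - 1) / (q - 1), E = (P q - 1) / (r - 1) and \<Delta> = D E - P^2. Eliminating r or q
  gives (q - 1) \<Delta> = (P - 1) (P + E) and (r - 1) \<Delta> = (P - 1) (P + D), so \<Delta> is a positive
  integer. If \<Delta> = 1, then D = P + v + k and E = P - v with k (P - v) = v^2 + 1; for fixed P the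
  factor q is largest and n = P q r is smallest when k = 1, where they are Q2 P and N2 P. If
  \<Delta> \<ge> 2, then q is so small compared with P that both bounds are strict.
  Writing P = p2 s rationalises the square root in Q2.

  For the explicit bound, write n = 4 m^10 and n = N2 (y^2 + 3/4), so that the bound to be
  estimated is Q2 (y^2 + 3/4). A truncated expansion of m^2 in powers of y^2 suffices.
\<close>

section \<open>Divisibility conditions on P, q and r\<close>

lemma korselt_number_reduce:
  assumes kn: "korselt_number n d p"
    and P: "P = (\<Prod>i=1..d-2. p i)" and q: "q = p (d - 1)"
  obtains r where "n = P * q * r" "odd P" "odd q" "odd r" "3 \<le> P" "5 \<le> q" "q + 2 \<le> r"
    "(q - 1) dvd (P * r - 1)" "(r - 1) dvd (P * q - 1)"
proof
  let ?r = "p d"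
  from kn have d: "d \<ge> 3" and n: "n = (\<Prod>i=1..d. p i)"
    and gt: "\<And>i. i \<in> {1..d} \<Longrightarrow> 1 < p i" and odd: "\<And>i. i \<in> {1..d} \<Longrightarrow> odd (p i)"
    and mono: "strict_mono_on {1..d} p"
    and dv: "\<And>i. i \<in> {1..d} \<Longrightarrow> (p i - 1) dvd (n - 1)"
    unfolding korselt_number_def by auto
  obtain e where e: "d = Suc (Suc e)" "e \<ge> 1"
    using d by (metis One_nat_def Suc_le_D Suc_le_mono numeral_3_eq_3)
  show nP: "n = P * q * ?r"
    unfolding n P q e by (simp add: prod.nat_ivl_Suc')
  show "odd P" unfolding P using odd by (subst even_prod_iff) auto
  show oq: "odd q" unfolding q using odd d by auto
  show or: "odd ?r" using odd d by auto
  have p3: "3 \<le> p 1" using gt[of 1] odd[of 1] d by (cases "p 1 = 2") auto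
  have "p 1 dvd P" unfolding P using d by (intro dvd_prodI) auto
  moreover have "P > 0" unfolding P using gt by (intro prod_pos) force
  ultimately show "3 \<le> P" using p3 zdvd_imp_le by fastforce
  have "p 1 < q" unfolding q using d by (intro strict_mono_onD[OF mono]) auto
  then show "5 \<le> q" using p3 oq by (cases "q = 4") auto
  have "q < ?r" unfolding q using d by (intro strict_mono_onD[OF mono]) auto
  then show "q + 2 \<le> ?r" using oq or by (cases "?r = q + 1") auto
  have "(q - 1) dvd (n - 1)" using dv[of "d - 1"] d unfolding q by simp
  \<comment> \<open>Modulo q - 1 the factor q of n is 1, which turns n - 1 into P r - 1. The same is
    done for r below.\<close>
  then have "(q - 1) dvd (n - 1) - P * ?r * (q - 1)" by (rule dvd_diff[OF _ dvd_triv_right])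
  moreover have "(n - 1) - P * ?r * (q - 1) = P * ?r - 1"
    unfolding nP by (simp add: algebra_simps)
  ultimately show "(q - 1) dvd (P * ?r - 1)" by simp
  have "(?r - 1) dvd (n - 1)" using dv[of d] d by simp
  then have "(?r - 1) dvd (n - 1) - P * q * (?r - 1)" by (rule dvd_diff[OF _ dvd_triv_right])
  moreover have "(n - 1) - P * q * (?r - 1) = P * q - 1"
    unfolding nP by (simp add: algebra_simps)
  ultimately show "(?r - 1) dvd (P * q - 1)" by simp
qed

lemma korselt_quotients:
  fixes P q r :: int
  assumes "3 \<le> P" "5 \<le> q" "q < r"
    and dq: "(q - 1) dvd (P * r - 1)" and dr: "(r - 1) dvd (P * q - 1)"
  obtains D E where "0 < E" "E < D" "P^2 < D * E"
    "(q - 1) * (D * E - P^2) = (P - 1) * (P + E)" "(r - 1) * (D * E - P^2) = (P - 1) * (P + D)"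
proof -
  from dq obtain D where D: "P * r - 1 = (q - 1) * D" by (elim dvdE)
  from dr obtain E where E: "P * q - 1 = (r - 1) * E" by (elim dvdE)
  have "3 * 5 \<le> P * q" using assms by (intro mult_mono) auto
  then have "(r - 1) * E > 0" using E by simp
  then have E0: "0 < E" using assms by (simp add: zero_less_mult_iff)
  have "P * q < P * r" using assms by simp
  then have "(r - 1) * E < (q - 1) * D" using D E by simp
  moreover have "(q - 1) * E \<le> (r - 1) * E" using E0 assms by (intro mult_right_mono) auto
  ultimately have "(q - 1) * E < (q - 1) * D" by simp
  then have ED: "E < D" using assms by simp
  \<comment> \<open>Multiply the equation for D by E and replace r E by P q - 1 + E. The second
    identity arises symmetrically, replacing q D in P times the equation for E or the like.\<close>
  have 1: "(q - 1) * (D * E - P^2) = (P - 1) * (P + E)"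
    using D E by algebra
  have 2: "(r - 1) * (D * E - P^2) = (P - 1) * (P + D)"
    using D E by algebra
  have "0 < (P - 1) * (P + E)" using assms E0 by simp
  then have "P^2 < D * E" using 1 assms by (smt (verit) mult_less_0_iff zero_less_mult_iff)
  then show thesis using that E0 ED 1 2 by blast
qed

section \<open>Parametrisation of \<open>Q2\<close> and \<open>N2\<close> by
  \<open>p2\<close>\<close>

lemma Q2_p2: "s \<ge> 0 \<Longrightarrow> Q2 (p2 s) = q2 s"
proof -
  assume "s \<ge> 0"
  moreover have "p2 s - 3/4 = (s + 1/2)^2" by (simp add: p2_def power2_eq_square field_simps)
  ultimately have "sqrt (p2 s - 3/4) = s + 1/2" by simp
  then show ?thesis
    by (simp add: Q2_def p2_def q2_def power_numeral_reduce field_simps)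
qed

lemma N2_p2: "N2 (p2 s) = n2 s"
  unfolding N2_def n2_def p2_def q2_def r2_def by algebra

lemma p2_surj:
  assumes "1 \<le> x" obtains s where "0 \<le> s" "p2 s = x"
proof
  \<comment> \<open>The larger root of s^2 + s + 1 = x.\<close>
  let ?s = "sqrt (x - 3/4) - 1/2"
  have "sqrt (1/4) \<le> sqrt (x - 3/4)" using assms by (intro real_sqrt_le_mono) simp
  then show "0 \<le> ?s" by (simp add: real_sqrt_divide)
  have "(sqrt (x - 3/4))^2 = x - 3/4" using assms by simp
  then show "p2 ?s = x" unfolding p2_def power2_eq_square by (simp add: field_simps)
qed

lemma q2_strict_mono: "strict_mono_on {0..} q2"
proof (rule strict_mono_onI)
  fix x y :: real assume "x \<in> {0..}" "y \<in> {0..}" "x < y"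
  then have xy: "0 \<le> x" "x < y" by auto
  have "x^k \<le> y^k" for k using xy by (intro power_mono) auto
  from this[of 2] this[of 3] this[of 4] show "q2 x < q2 y"
    unfolding q2_def using xy by linarith
qed

text \<open>Gives the factor q itself a parameter t, so that for \<Delta> \<ge> 2 the bound on q
  follows from n2 t < n by monotonicity.\<close>

lemma q2_surj:
  assumes "1 < x" obtains t where "0 < t" "q2 t = x"
proof -
  have "bij_betw q2 {0..} {1..}"
  proof (rule bij_betw_of_strict_mono_ge_id[OF q2_strict_mono])
    show "continuous_on {0..} q2" unfolding q2_def by (intro continuous_intros)
  qed (auto simp: q2_def)
  then have "x \<in> q2 ` {0..}" using assms by (simp add: bij_betw_def)
  then obtain t where t: "0 \<le> t" "q2 t = x" by auto
  moreover have "t \<noteq> 0" using t assms by (auto simp: q2_def)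
  ultimately show thesis using that[of t] by simp
qed

section \<open>Polynomial inequalities for \<Delta> \<ge> 2\<close>

text \<open>Cancelling q = \<open>q2 t\<close> from n2 t < P q r leaves this claim. To leading order
  \<open>le\<close> makes P at least sqrt 3 * t^2, hence P r at least 2 sqrt 3 * t^6 against 2 t^6.
  The exact estimate below also covers small t.\<close>

lemma p2_r2_less_of_det_ge_3:
  assumes t: "0 \<le> t" and P: "1 \<le> P" and r: "q2 t + 2 \<le> r"
    and le: "3 * (q2 t - 1) \<le> 2 * P * (P - 1)"
  shows "p2 t * r2 t < P * r"
proof (rule ccontr)
  let ?c = "q2 t + 2" and ?R = "p2 t * r2 t"
  assume "\<not> ?R < P * r"
  moreover have "P * ?c \<le> P * r" using P r by (intro mult_left_mono) auto
  ultimately have Pc: "P * ?c \<le> ?R" by simp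
  have c: "?c > 0" using t unfolding q2_def by (intro add_nonneg_pos) auto
  have Pc1: "?c \<le> P * ?c" using P c mult_right_mono[of 1 P ?c] by simp
  \<comment> \<open>After scaling by \<open>?c^2\<close>, P occurs only through
    \<open>P * ?c\<close>, which the negated claim bounds by \<open>?R\<close>. This leaves a
    polynomial inequality in t alone.\<close>
  have "3 * (q2 t - 1) * ?c^2 \<le> 2 * P * (P - 1) * ?c^2"
    using le by (intro mult_right_mono) auto
  also have "\<dots> = 2 * ((P * ?c) * (P * ?c - ?c))" by algebra
  also have "(P * ?c) * (P * ?c - ?c) \<le> ?R * (?R - ?c)"
    using Pc Pc1 c by (intro mult_mono[of "P * ?c" ?R "P * ?c - ?c"]) linarith+
  finally have "3 * (q2 t - 1) * ?c^2 - 2 * (?R * (?R - ?c)) \<le> 0" by simp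
  moreover have "3 * (q2 t - 1) * ?c^2 - 2 * (?R * (?R - ?c)) =
      4 + 66*t + 163*t^2 + 259*t^3 + 286*t^4 + 196*t^5 + t^6 * (65 - 19*t - 11*t^2 + 41*t^3)
      + 76*t^10 + 52*t^11 + 16*t^12"
    unfolding p2_def q2_def r2_def by algebra
  \<comment> \<open>The negative coefficients are confined to this cubic: 65 dominates them for t
    \<le> 1, and 41 t^3 does so for t > 1.\<close>
  moreover have "65 - 19*t - 11*t^2 + 41*t^3 \<ge> 0"
  proof (cases "t \<le> 1")
    case True
    then have "t^2 \<le> 1" using t by (simp add: power_le_one)
    then show ?thesis using True zero_le_power[OF t, of 3] by linarith
  next
    case False
    then have "t \<le> t^3" "t^2 \<le> t^3"
      using power_increasing[of 1 3 t] power_increasing[of 2 3 t] by auto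
    then show ?thesis using False by linarith
  qed
  ultimately show False
    using t zero_le_power[OF t] mult_nonneg_nonneg[of "t^6" "65 - 19*t - 11*t^2 + 41*t^3"]
    by (smt (verit))
qed

text \<open>The counterpart for \<Delta> = 2: the bound on q is weaker to leading order, which the
  larger gap between q and r compensates.\<close>

lemma p2_r2_less_of_det_2:
  assumes t: "0 < t" and P: "1 \<le> P" and r: "q2 t + 3 * (P - 1) \<le> r"
    and le: "q2 t - 1 \<le> (P - 1)^2"
  shows "p2 t * r2 t < P * r"
proof (rule ccontr)
  let ?w = "P - 1" and ?c = "q2 t + 3" and ?R = "p2 t * r2 t"
  assume "\<not> ?R < P * r"
  moreover have "P * (q2 t + 3 * ?w) \<le> P * r" using P r by (intro mult_left_mono) auto
  \<comment> \<open>\<open>le\<close> is used twice: here it replaces ?w^2 by q2 t - 1, and after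
    squaring it removes the remaining ?w.\<close>
  moreover have "P * (q2 t + 3 * ?w) = q2 t + ?w * ?c + 3 * ?w^2" by algebra
  ultimately have C: "?w * ?c \<le> ?R - 4 * q2 t + 3" using le by simp
  have c: "?c > 0" using t unfolding q2_def by (intro add_nonneg_pos) auto
  have "(q2 t - 1) * ?c^2 \<le> ?w^2 * ?c^2" using le by (intro mult_right_mono) auto
  also have "\<dots> = (?w * ?c)^2" by (simp add: power_mult_distrib)
  also have "\<dots> \<le> (?R - 4 * q2 t + 3)^2" using C P c by (intro power_mono) auto
  finally have "(q2 t - 1) * ?c^2 - (?R - 4 * q2 t + 3)^2 \<le> 0" by simp
  moreover have "(q2 t - 1) * ?c^2 - (?R - 4 * q2 t + 3)^2 =
      32*t + 64*t^2 + 136*t^3 + 248*t^4 + 346*t^5 + 399*t^6 + 327*t^7 + 194*t^8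
      + 81*t^9 + 21*t^10 + 8*t^11 + 4*t^12"
    unfolding p2_def q2_def r2_def by algebra
  moreover have "\<dots> > 0" using t by (intro add_pos_pos) auto
  ultimately show False by simp
qed

section \<open>Bounds on q and n according to \<Delta>\<close>

lemma korselt_det_1:
  fixes P q r D E :: int
  assumes P: "3 \<le> P" and E: "0 < E" "E < D" and det: "D * E = P^2 + 1"
    and q: "q - 1 = (P - 1) * (P + E)" and r: "r - 1 = (P - 1) * (P + D)"
  shows "real_of_int q \<le> Q2 P" "N2 P \<le> real_of_int (P * q * r)"
    "real_of_int q = Q2 P \<Longrightarrow> real_of_int (P * q * r) = N2 P"
proof -
  have EP: "E < P"
  proof (rule ccontr)
    assume "\<not> E < P"
    then have "(P + 1) * P \<le> D * E" using P E by (intro mult_mono) auto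
    then show False using det P by (simp add: power2_eq_square algebra_simps)
  qed
  have DP: "P < D"
  proof (rule ccontr)
    assume "\<not> P < D"
    then have "D * E \<le> P * P" using P E EP by (intro mult_mono) auto
    then show False using det by (simp add: power2_eq_square)
  qed
  define v where "v = P - E"
  define k where "k = D + E - 2 * P"
  have D': "D = P + v + k" and E': "E = P - v" by (auto simp: v_def k_def)
  have v: "0 < v" "v < P" using EP E by (auto simp: v_def)
  have Pk: "k * (P - v) = v^2 + 1"
    using det unfolding D' E' by (simp add: power2_eq_square algebra_simps)
  then have k: "1 \<le> k" using v by (smt (verit) zero_le_power2 zero_less_mult_iff)
  \<comment> \<open>By \<open>Pk\<close>, (2 P - v) (2 P + v + k) = 4 P^2 + k P + 1. So v drops out
    and n is linear in k with positive slope; its value at k = 1 is \<open>N2 P\<close>.\<close>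
  have nk: "P * q * r = P * ((P - 1)^2 * (4 * P^2 + P + 1) + (P - 1) * (4 * P + 1) + 1)
      + P * (P - 1) * (k - 1) * (P * (P - 1) + 1)"
  proof -
    have "q = 1 + (P - 1) * (2 * P - v)" "r = 1 + (P - 1) * (2 * P + v + k)"
      using q r unfolding D' E' by (simp_all add: algebra_simps)
    then show ?thesis using Pk by algebra
  qed
  have N: "N2 P = real_of_int (P * ((P - 1)^2 * (4 * P^2 + P + 1) + (P - 1) * (4 * P + 1) + 1))"
    unfolding N2_def of_int_mult of_int_add of_int_diff of_int_power of_int_1 of_int_numeral
    by algebra
  have "0 \<le> P * (P - 1) * (k - 1) * (P * (P - 1) + 1)" using P k by simp
  then show "N2 P \<le> real_of_int (P * q * r)" unfolding N nk by linarith
  obtain s where s: "0 \<le> s" "p2 s = P" using p2_surj[of P] P by auto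
  have qv: "real_of_int q = 1 + (P - 1) * (2 * P - v)"
    using arg_cong[OF q, of real_of_int] unfolding E' by simp
  \<comment> \<open>Q2 P has the shape of q with the real s in place of v, so the bound on q amounts
    to s \<le> v. This follows from k \<ge> 1, which by \<open>Pk\<close> gives P \<le> p2
    v.\<close>
  have "q2 s = 1 + (p2 s - 1) * (2 * p2 s - s)" unfolding p2_def q2_def by algebra
  then have "Q2 P = 1 + (P - 1) * (2 * P - s)" using Q2_p2[OF s(1)] s(2) by simp
  then have diff: "Q2 P - q = (P - 1) * (v - s)" unfolding qv by (simp add: algebra_simps)
  have "P - v \<le> v^2 + 1" using mult_right_mono[of 1 k "P - v"] k v Pk by simp
  then have "real_of_int (P - v) \<le> real_of_int (v^2 + 1)" by (simp only: of_int_le_iff)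
  then have vs: "p2 s \<le> p2 v" unfolding s(2) by (simp add: p2_def)
  have sv: "s \<le> v"
  proof (rule ccontr)
    assume "\<not> s \<le> v"
    then have "real_of_int v < s" "(real_of_int v)^2 \<le> s^2" using v by (auto intro!: power_mono)
    then show False using vs by (simp add: p2_def)
  qed
  then have "0 \<le> (real_of_int P - 1) * (v - s)" using P by simp
  then show "real_of_int q \<le> Q2 P" using diff by simp
  show "real_of_int (P * q * r) = N2 P" if "real_of_int q = Q2 P"
  proof -
    \<comment> \<open>Equality makes s the integer v; then P = v^2 + v + 1 and \<open>Pk\<close>
      forces k = 1.\<close>
    have "s = v" using that diff P by simp
    then have "real_of_int P = real_of_int (v^2 + v + 1)" using s by (simp add: p2_def)
    then have "P = v^2 + v + 1" by (simp only: of_int_eq_iff)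
    then have "k * (v^2 + 1) = 1 * (v^2 + 1)" using Pk by simp
    moreover have "v^2 + 1 \<noteq> 0" by (smt (verit) zero_le_power2)
    ultimately have "k = 1" by (simp only: mult_cancel_right) simp
    then show ?thesis unfolding N nk by simp
  qed
qed

text \<open>AM-GM applied to P - 3/4 and 1. It serves \<Delta> \<ge> 2, where q - 1 \<le> P (P -
  1).\<close>

lemma Q2_gt:
  assumes "3 \<le> P" shows "P * (P - 1) + 1 < Q2 P"
proof -
  have "sqrt (P - 3/4) \<le> sqrt (((P + 1/4) / 2)^2)"
    using zero_le_power2[of "P - 7/4"] assms
    by (intro real_sqrt_le_mono) (simp add: power2_eq_square field_simps)
  then have "sqrt (P - 3/4) \<le> (P + 1/4) / 2" using assms by simp
  then have "P < 2 * P + 1/2 - sqrt (P - 3/4)" using assms by (simp add: field_simps)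
  then have "(P - 1) * P < (P - 1) * (2 * P + 1/2 - sqrt (P - 3/4))"
    using assms by (intro mult_strict_left_mono) auto
  then show ?thesis by (simp add: Q2_def mult.commute)
qed

lemma korselt_det_ge_2:
  fixes P q r D E :: int
  assumes P: "3 \<le> P" "odd P" and q5: "5 \<le> q" and qr: "q + 2 \<le> r" and E: "0 < E" "E < D"
    and det: "P^2 + 2 \<le> D * E"
    and q: "(q - 1) * (D * E - P^2) = (P - 1) * (P + E)"
    and r: "(r - 1) * (D * E - P^2) = (P - 1) * (P + D)"
    and t: "0 < t" "q2 t = q"
  shows "real_of_int q < Q2 P" "n2 t < real_of_int (P * q * r)"
proof -
  let ?k = "D * E - P^2"
  have n2: "n2 t < real_of_int (P * q * r)" if "p2 t * r2 t < real_of_int P * r"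
    using mult_strict_right_mono[OF that, of q] q5 t by (simp add: n2_def mult_ac)
  have "real_of_int q < Q2 P \<and> n2 t < real_of_int (P * q * r)"
  proof (cases "?k = 2")
    case True
    \<comment> \<open>As P is odd, D and E are odd when \<Delta> = 2. This sharpens E \<le> P - 1
      and then P + 3 \<le> D by one each, whence r - q = (P - 1) (D - E) / 2 \<ge> 3 (P -
      1).\<close>
    have odd: "odd (D * E)"
    proof -
      have "D * E = P^2 + 2" using True by simp
      then show ?thesis using P by (simp only: even_add even_power) simp
    qed
    have "E < P"
    proof (rule ccontr)
      assume "\<not> E < P"
      then have "(P + 1) * P \<le> D * E" using P E by (intro mult_mono) auto
      then show False using True P by (simp add: power2_eq_square algebra_simps)
    qed
    moreover have "E \<noteq> P - 1" using odd P by auto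
    ultimately have EP: "E \<le> P - 2" by simp
    have "P + 3 \<le> D"
    proof (rule ccontr)
      assume "\<not> P + 3 \<le> D"
      then have "D * E \<le> (P + 2) * (P - 2)" using P E EP by (intro mult_mono) auto
      then show False using True by (simp add: power2_eq_square algebra_simps)
    qed
    moreover have "D \<noteq> P + 3" using odd P by auto
    ultimately have DP: "D \<ge> P + 4" by simp
    have "(q - 1) * 2 \<le> (P - 1) * (2 * (P - 1))"
      using q EP P unfolding True by (simp add: mult_left_mono)
    also have "\<dots> = (P - 1)^2 * 2" by (simp add: power2_eq_square)
    finally have q1: "q - 1 \<le> (P - 1)^2" by simp
    have "(r - q) * 2 = (P - 1) * (D - E)"
      using q r unfolding True by (simp add: algebra_simps)
    moreover have "(P - 1) * 6 \<le> (P - 1) * (D - E)" using P EP DP by (intro mult_left_mono) auto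
    ultimately have r1: "q + 3 * (P - 1) \<le> r" by simp
    have "real_of_int (q - 1) \<le> real_of_int ((P - 1)^2)" using q1 by (simp only: of_int_le_iff)
    then have "q2 t - 1 \<le> (real_of_int P - 1)^2" using t by simp
    moreover have "real_of_int (q + 3 * (P - 1)) \<le> r" using r1 by (simp only: of_int_le_iff)
    ultimately have "p2 t * r2 t < real_of_int P * r"
      using P t by (intro p2_r2_less_of_det_2) auto
    moreover have "(P - 1)^2 \<le> P * (P - 1)" using P by (simp add: power2_eq_square mult_right_mono)
    then have "real_of_int q \<le> real_of_int (P * (P - 1) + 1)" using q1 by (simp only: of_int_le_iff)
    then have "real_of_int q < Q2 P" using Q2_gt[of P] P by simp
    ultimately show ?thesis using n2 by simp
  next
    case False
    then have k3: "3 \<le> ?k" using det by simp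
    have "3 * (q - 1) \<le> 2 * P * (P - 1)"
    proof (cases "E \<le> P")
      case True
      have "3 * (q - 1) \<le> (q - 1) * ?k" using k3 q5 by (subst mult.commute, intro mult_left_mono) auto
      also have "\<dots> \<le> (P - 1) * (2 * P)" unfolding q using True P by (intro mult_left_mono) auto
      finally show ?thesis by (simp add: algebra_simps)
    next
      case False
      \<comment> \<open>For E > P, the bound D \<ge> E + 1 gives \<Delta> \<ge> (E - P) (E + P) + E
        \<ge> P + E, which forces q \<le> P.\<close>
      have "1 * (E + P) \<le> (E - P) * (E + P)" using False P by (intro mult_right_mono) auto
      moreover have "E * (E + 1) \<le> D * E" using E by (subst (2) mult.commute, intro mult_left_mono) auto
      ultimately have "P + E \<le> ?k" using E by (simp add: power2_eq_square algebra_simps)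
      then have "(P - 1) * (P + E) \<le> (P - 1) * ?k" using P by (intro mult_left_mono) auto
      then have "(q - 1) * ?k \<le> (P - 1) * ?k" using q by simp
      then have "q - 1 \<le> P - 1" using k3 by (simp add: mult_le_cancel_right)
      moreover have "3 * (P - 1) \<le> 2 * P * (P - 1)" using P by (intro mult_right_mono) auto
      ultimately show ?thesis by simp
    qed
    then have le: "real_of_int (3 * (q - 1)) \<le> real_of_int (2 * P * (P - 1))"
      by (simp only: of_int_le_iff)
    then have le: "3 * (real_of_int q - 1) \<le> 2 * real_of_int P * (real_of_int P - 1)" by simp
    have "p2 t * r2 t < real_of_int P * r"
      using P qr t le by (intro p2_r2_less_of_det_ge_3) auto
    moreover have "0 \<le> real_of_int P * (real_of_int P - 1)" using P by simp
    then have "real_of_int q < Q2 P" using le[unfolded mult.assoc] Q2_gt[of P] by (simp add: P)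
    ultimately show ?thesis using n2 by simp
  qed
  then show "real_of_int q < Q2 P" "n2 t < real_of_int (P * q * r)" by auto
qed

section \<open>The explicit bound in radicals\<close>

lemma Q2_le_radicals:
  assumes y: "11/10 \<le> y" and m: "0 \<le> m" and N: "N2 (y^2 + 3/4) = 4 * m^10"
  shows "Q2 (y^2 + 3/4) \<le> 2 * m^4 - m^3 - 1/10 * m^2 + 17/20 * m"
proof -
  define z where "z = y^2"
  define M where "M = m^2"
  define c where "c = z + 2/5 + 1 / (15 * z)"
  have "(11/10)^2 \<le> z" unfolding z_def using y by (intro power_mono) auto
  then have z: "6/5 \<le> z" by (simp add: power2_eq_square)
  have cz: "z \<le> c" unfolding c_def using z by simp
  \<comment> \<open>The asymptotic expansion is m^2 = z + 2/5 + (\<alpha> + o(1)) / z; the constant 1/15 is below \<alpha>,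
    yet large enough for the comparison of \<open>g c\<close> with Q2.\<close>
  have "4 * c^5 \<le> N2 (z + 3/4)"
  proof -
    \<comment> \<open>Since z \<ge> 6/5, the two positive leading terms are at least multiples of
      z^6 that outweigh all the negative terms, each bounded by a multiple of z^6.\<close>
    have "N2 (z + 3/4) * z^5 - 4 * (z^2 + 2/5 * z + 1/15)^5 =
        23/30*z^8 + 23/75*z^7 - 46199/72000*z^6 - 61219/150000*z^5 - 2216/16875*z^4
        - 352/16875*z^3 - 116/50625*z^2 - 8/50625*z - 4/759375"
      unfolding N2_def by (simp add: field_simps power_numeral_reduce)
    moreover have "6/5 * z^7 \<le> z^8" "6/5 * z^6 \<le> z^7"
      using z mult_right_mono[of "6/5" z "z^7"] mult_right_mono[of "6/5" z "z^6"]
      by (auto simp flip: power_Suc)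
    moreover have "z^5 \<le> z^6" "z^4 \<le> z^6" "z^3 \<le> z^6" "z^2 \<le> z^6" "z \<le> z^6" "1 \<le> z^6"
      using z power_increasing[of 1 6 z] by (auto intro!: power_increasing)
    ultimately have "N2 (z + 3/4) * z^5 - 4 * (z^2 + 2/5 * z + 1/15)^5 \<ge> 0"
      by linarith
    moreover have "c * z = z^2 + 2/5 * z + 1/15"
      unfolding c_def using z by (simp add: field_simps power2_eq_square)
    then have "c^5 * z^5 = (z^2 + 2/5 * z + 1/15)^5" by (simp flip: power_mult_distrib)
    ultimately have "4 * c^5 * z^5 \<le> N2 (z + 3/4) * z^5" by simp
    then show ?thesis using z by (simp add: mult_le_cancel_right)
  qed
  also have "\<dots> = 4 * M^5" using N by (simp add: z_def M_def flip: power_mult)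
  finally have "c^5 \<le> M^5" by simp
  then have cM: "c \<le> M" by (rule power_le_imp_le_base[of _ 4, simplified]) (simp add: M_def)
  define i where "i = 1 / y"
  have i: "0 < i" "i \<le> 10/11" "i * y = 1" using y by (auto simp: i_def field_simps)
  have "2 * m * y \<le> M + z"
    using zero_le_power2[of "m - y"] by (simp add: M_def z_def power2_eq_square algebra_simps)
  then have "2 * m * y * i \<le> (M + z) * i" using i by (intro mult_right_mono) auto
  then have mi: "m \<le> (M + z) * i / 2" using i by (simp add: mult.assoc mult.commute[of y i])
  \<comment> \<open>AM-GM removes the odd powers of m, leaving a quadratic in M.\<close>
  define g where "g x = 2 * x^2 - x/10 - (x + z) * i / 2 * (x - 17/20)" for x
  have "g M \<le> 2 * M^2 - M/10 - m * (M - 17/20)"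
    unfolding g_def using mi cM cz z by (simp add: mult_right_mono)
  also have "\<dots> = 2 * m^4 - m^3 - 1/10 * m^2 + 17/20 * m"
    by (simp add: M_def power_numeral_reduce algebra_simps)
  finally have gM: "g M \<le> 2 * m^4 - m^3 - 1/10 * m^2 + 17/20 * m" .
  \<comment> \<open>The factored form of g M - g c. As i < 1, both factors are nonnegative, so
    replacing M by c can only lower g.\<close>
  have "0 \<le> (M - c) * (2 * (M + c) - 1/10 - (M + c + z - 17/20) * i / 2)"
  proof (intro mult_nonneg_nonneg)
    have "(M + c + z - 17/20) * i \<le> (M + c + z - 17/20) * 1"
      using i cM cz z by (intro mult_left_mono) auto
    then show "0 \<le> 2 * (M + c) - 1/10 - (M + c + z - 17/20) * i / 2"
      using cM cz z by argo
  qed (use cM in simp)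
  also have "\<dots> = g M - g c" unfolding g_def by (simp add: field_simps power2_eq_square)
  finally have gc: "g c \<le> g M" by simp
  have Q: "Q2 (y^2 + 3/4) = (z - 1/4) * (2 * z + 2 - z * i) + 1"
    unfolding Q2_def z_def i_def using y by (simp add: power2_eq_square field_simps)
  define j where "j = 1 / z"
  have j: "0 < j" "j \<le> 1" "j * z = 1" using z by (auto simp: j_def)
  have c': "c = z + 2/5 + j / 15" by (simp add: c_def j_def)
  have A: "i * (1/100 - j/600 + j^2/450) \<le> 1 * (1/100 + 1/450)" (is "?A \<le> _")
    using i j power_le_one[of j 2] by (intro mult_mono) auto
  have B: "0 \<le> j/10 + 2/225 * j^2" using j(1) by (intro add_nonneg_nonneg) auto
  have "0 \<le> 7/150 + b - a" if "a \<le> 1 * (1/100 + 1/450)" "0 \<le> b" for a b :: real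
    using that by simp
  from this[OF A B] have "0 \<le> 7/150 + j/10 + 2/225 * j^2 - ?A + (4/15 - i/10) * (j * z - 1)"
    using j(3) by (simp add: add.assoc)
  \<comment> \<open>The coefficients 1/10 and 17/20 make the terms in z and z i cancel, leaving the
    constant 7/150 and small terms. The summand with j z - 1 vanishes; including it makes this a
    polynomial identity in independent z, i and j.\<close>
  also have "\<dots> = g c - ((z - 1/4) * (2 * z + 2 - z * i) + 1)"
    unfolding g_def c' by (simp add: field_simps power2_eq_square)
  finally have "Q2 (y^2 + 3/4) \<le> g c" unfolding Q by simp
  then show ?thesis using gc gM by linarith
qed

section \<open>Comparison through the inverse functions\<close>

lemma n2_inv:
  assumes "1 \<le> x"
  shows "0 \<le> n2_inv x" "n2 (n2_inv x) = x"
proof -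
  have inj: "inj_on n2 {0..}" and im: "x \<in> n2 ` {0..}"
    using n2_bij assms by (auto simp: bij_betw_def)
  show "n2 (n2_inv x) = x" unfolding n2_inv_def using inj im by (rule f_the_inv_into_f)
  show "0 \<le> n2_inv x" using the_inv_into_into[OF inj im, of "{0..}"] by (simp add: n2_inv_def)
qed

lemma n2_less_iff: "0 \<le> s \<Longrightarrow> 0 \<le> t \<Longrightarrow> n2 s < n2 t \<longleftrightarrow> s < t"
  using strict_mono_on_less[OF n2_strict_mono, of s t] by simp

lemma q2_less_iff: "0 \<le> s \<Longrightarrow> 0 \<le> t \<Longrightarrow> q2 s < q2 t \<longleftrightarrow> s < t"
  using strict_mono_on_less[OF q2_strict_mono, of s t] by simp

theorem theorem3p5:
  fixes n :: int and d :: nat and p :: "nat \<Rightarrow> int" and P q :: int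
  assumes "korselt_number n d p"
    and "P = (\<Prod>i=1..d-2. p i)"
    and "q = p (d - 1)"
  shows "real_of_int q \<le> Q2 (N2_inv (real_of_int n))
    \<and> Q2 (N2_inv (real_of_int n)) = q2 (n2_inv (real_of_int n))
    \<and> (real_of_int q = Q2 (N2_inv (real_of_int n)) \<longleftrightarrow> real_of_int q = Q2 (real_of_int P))
    \<and> Q2 (real_of_int P) =
        (real_of_int P - 1) * (2 * real_of_int P + 1/2 - sqrt (real_of_int P - 3/4)) + 1
    \<and> q \<le> \<lfloor>root 5 (2 * (real_of_int n)^2) - root 10 ((real_of_int n)^3 / 64)
            - 1/10 * root 5 (real_of_int n / 4) + 17/20 * root 10 (real_of_int n / 4)\<rfloor>"
proof -
  obtain r where r: "n = P * q * r" "odd P" "3 \<le> P" "5 \<le> q" "q + 2 \<le> r"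
    "(q - 1) dvd (P * r - 1)" "(r - 1) dvd (P * q - 1)"
    using korselt_number_reduce[OF assms] by metis
  have qr: "q < r" using r by simp
  obtain D E where DE: "0 < E" "E < D" "P^2 < D * E"
    "(q - 1) * (D * E - P^2) = (P - 1) * (P + E)" "(r - 1) * (D * E - P^2) = (P - 1) * (P + D)"
    using korselt_quotients[OF r(3,4) qr r(6,7)] by blast
  have "1 * 1 * 1 \<le> P * q * r" using r by (intro mult_mono) auto
  then have n1: "1 \<le> real_of_int n" unfolding r(1) by linarith
  define s where "s = n2_inv n"
  have s: "0 \<le> s" "n2 s = n" using n2_inv[OF n1] by (auto simp: s_def)
  have inv: "N2_inv n = p2 s"
    unfolding N2_inv_def
  proof (rule the_inv_into_f_eq)
    show "inj_on N2 {1..}" using N2_bij by (simp add: bij_betw_def)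
    show "N2 (p2 s) = n" using s by (simp add: N2_p2)
    show "p2 s \<in> {1..}" using s by (simp add: p2_def)
  qed
  have Qq: "Q2 (N2_inv n) = q2 s" using Q2_p2 s inv by simp
  have main: "real_of_int q \<le> q2 s \<and> (real_of_int q = q2 s \<longleftrightarrow> real_of_int q = Q2 P)"
  proof (cases "D * E = P^2 + 1")
    case True
    have *: "real_of_int q \<le> Q2 P" "N2 P \<le> n" "real_of_int q = Q2 P \<Longrightarrow> n = N2 P"
      using korselt_det_1[of P E D q r] True DE r by auto
    obtain u where u: "0 \<le> u" "p2 u = P" using p2_surj[of P] r by auto
    \<comment> \<open>With u the parameter of P and s that of n, N2 P \<le> n gives u \<le> s, hence
      q \<le> q2 u \<le> q2 s. Either equality for q forces u = s.\<close>
    have "N2 P = n2 u" "Q2 P = q2 u" using u N2_p2[of u] Q2_p2[of u] by auto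
    with * s u show ?thesis using n2_less_iff[of s u] q2_less_iff[of s u]
        inj_onD[OF bij_betw_imp_inj_on[OF n2_bij], of s u] by force
  next
    case False
    obtain t where t: "0 < t" "q2 t = q" using q2_surj[of q] r by auto
    have "real_of_int q < Q2 P" "n2 t < n"
      using korselt_det_ge_2[of P q r E D t] False DE r t by auto
    \<comment> \<open>n2 t < n = n2 s gives t < s, so q = q2 t < q2 s and both sides of the
      equivalence fail.\<close>
    moreover from this have "q2 t < q2 s"
      using s t n2_less_iff[of t s] q2_less_iff[of t s] by auto
    ultimately show ?thesis using t by simp
  qed
  define m where "m = root 10 (n / 4)"
  have m: "0 \<le> m" "n = 4 * m^10" using n1 by (auto simp: m_def)
  have "root 5 (2 * (real_of_int n)^2) = 2 * m^4"
    using m by (intro real_root_pos_unique) (auto simp: power_mult_distrib simp flip: power_mult)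
  moreover have "root 10 ((real_of_int n)^3 / 64) = m^3"
    using m by (intro real_root_pos_unique) (auto simp: power_mult_distrib simp flip: power_mult)
  moreover have "root 5 (real_of_int n / 4) = m^2"
    using m by (intro real_root_pos_unique) (auto simp flip: power_mult)
  moreover have "q2 s \<le> 2 * m^4 - m^3 - 1/10 * m^2 + 17/20 * m"
  proof -
    \<comment> \<open>q2 (3/5) < 5 \<le> q \<le> q2 s; this yields the lower bound 11/10 on y = s +
      1/2.\<close>
    have "q2 (3/5) < q2 s" using main r by (simp add: q2_def power_numeral_reduce)
    then have "11/10 \<le> s + 1/2" using q2_less_iff[of "3/5" s] s by simp
    moreover have y: "(s + 1/2)^2 + 3/4 = p2 s" by (simp add: p2_def power2_eq_square field_simps)
    ultimately show ?thesis
      using Q2_le_radicals[of "s + 1/2" m] m s N2_p2[of s] Q2_p2[of s] unfolding y by simp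
  qed
  ultimately have "q \<le> \<lfloor>root 5 (2 * (real_of_int n)^2) - root 10 ((real_of_int n)^3 / 64)
            - 1/10 * root 5 (real_of_int n / 4) + 17/20 * root 10 (real_of_int n / 4)\<rfloor>"
    using main by (simp add: le_floor_iff m_def)
  with main show ?thesis using Qq by (simp add: s_def Q2_def)
qed

end
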